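(* Let $U\in\mathbb{R}^{n\times n}$. (i) Let $\mathcal{Z}=\{\Delta\in\mathbb{R}^{n\times n}:\ \mathrm{vec}(\Delta)\in\mathcal{U}\subset\mathbb{R}^{n^2}\}$. Then $\delta^*_{\mathcal{Z}}(U)=\delta^*_{\mathcal{U}}(\mathrm{vec}(U))$. (ii) Let $\Delta^1,\dots,\Delta^k\in\mathbb{R}^{n\times n}$ be given and let $\mathcal{Z}=\{\sum_{i=1}^k\zeta_i\Delta^i:\ \zeta\in\mathcal{U}\subseteq\mathbb{R}^k\}$. Then $\delta^*_{\mathcal{Z}}(U)=\delta^*_{\mathcal{U}}\big([\mathrm{trace}(\Delta^iU^T)]_{i=1,\dots,k}\big)$. (iii) Let $L\in\mathbb{R}^{n\times t}$ and $R\in\mathbb{R}^{s\times n}$ be given and $\mathcal{Z}=\{L\Delta R:\ \Delta\in\mathcal{U}\subseteq\mathbb{R}^{t\times s}\}$. Then $\delta^*_{\mathcal{Z}}(U)=\delta^*_{\mathcal{U}}(L^TUR^T)$. (iv) Let $L\in\mathbb{R}^{n\times n}$ be given and $\mathcal{Z}=\{\Delta:\ L\circ\Delta\in\mathcal{U}\subseteq\mathbb{R}^{n\times n}\}$. Then $$\delta^*_{\mathcal{Z}}(U)=\begin{cases}\delta^*_{\mathcal{U}}(U\circ L^\dagger)&\text{if }U_{ij}=0\text{ for all }i,j=1,\dots,n\text{ such that }L_{ij}=0,\\ +\infty&\text{if }U_{ij}\neq 0\text{ for some }i,j=1,\dots,n\text{ such that }L_{ij}=0,\end{cases}$$ where $L^\dagger_{ij}=1/L_{ij}$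 if $L_{ij}\ne 0$ and $L^\dagger_{ij}=0$ otherwise. (v) Let $\mathcal{Z}_i\subseteq\mathbb{R}^{n\times n}$, $i=1,\dots,k$, and let $\mathcal{Z}=\sum_{i=1}^k\mathcal{Z}_i$ be the Minkowski sum. Then $\delta^*_{\mathcal{Z}}(U)=\sum_{i=1}^k\delta^*_{\mathcal{Z}_i}(U)$. (vi) Let $\mathcal{Z}_i\subseteq\mathbb{R}^{n\times n}$, $i=1,\dots,k$, each be of the form $$\left\{\Delta\in\mathbb{R}^{n\times n}:\ \mathrm{trace}(C^{j\,T}\Delta)+q^j=0,\ j=1,\dots,I;\ \ h_\ell(\Delta)\le 0,\ \ell=1,\dots,L;\ \ g_r(\Delta)\preceq 0_{p\times p},\ r=1,\dots,K\right\}$$ (with data depending on $i$, as described in the context), and suppose that they have a common Slater point. Let $\mathcal{Z}=\bigcap_{i=1}^k\mathcal{Z}_i$. Then $$\delta^*_{\mathcal{Z}}(U)=\min_{U^1,\dots,U^k\in\mathbb{R}^{n\times n}}\left\{\sum_{i=1}^k\delta^*_{\mathcal{Z}_i}(U^i):\ \sum_{i=1}^kU^i=U\right\}.$$ (vii) Let $\mathcal{Z}_i\subseteq\mathbb{R}^{n_i\times n_i}$, $U_i\in\mathbb{R}^{n_i\times n_i}$, $i=1,\dots,k$, and $\mathcal{Z}=\{\Delta=(\Delta_1,\dots,\Delta_k):\ \Delta_i\in\mathcal{Z}_i,\ i=1,\dots,k\}$. Then $\delta^*_{\mathcal{Z}}((U_1,\dots,U_k))=\sum_{i=1}^k\delta^*_{\mathcal{Z}_i}(U_i)$.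 (viii) Let $\mathcal{Z}_i\subseteq\mathbb{R}^{n\times n}$, $i=1,\dots,k$, be convex and let $\mathcal{Z}=\mathrm{conv}(\bigcup_{i=1}^k\mathcal{Z}_i)$ be the convex hull. Then $\delta^*_{\mathcal{Z}}(U)=\max_{i=1,\dots,k}\delta^*_{\mathcal{Z}_i}(U)$.
   Context: Support function: for a convex set $\mathcal{Z}\subseteq\mathbb{R}^d$ and $u\in\mathbb{R}^d$, $\delta^*_{\mathcal{Z}}(u):=\sup_{b\in\mathcal{Z}}u^Tb$; for a convex set $\mathcal{Z}\subseteq\mathbb{R}^{m\times n}$ and $U\in\mathbb{R}^{m\times n}$, $\delta^*_{\mathcal{Z}}(U):=\sup_{\Delta\in\mathcal{Z}}\mathrm{trace}(\Delta U^T)$; values in the extended reals. For tuples of matrices as in (vii) the pairing is $\sum_{i}\mathrm{trace}(\Delta_iU_i^T)$. All sets whose support function is taken are convex. $\mathrm{vec}(A)$ lists the entries of $A$ row by row, so $\mathrm{trace}(AB^T)=\mathrm{vec}(A)^T\mathrm{vec}(B)$. $[d_i]_{i=1,\dots,k}$ is the vector with components $d_i$. $\circ$ is the Hadamard (entrywise) product. $M\preceq N$ means $N-M$ is symmetric positive semi-definite, $M\prec N$ that $N-M$ is symmetric positive definite. In (vi): $p$ is a positive integer, $C^j\in\mathbb{R}^{n\times n}$, $q^j\in\mathbb{R}$, $h_\ell:\mathbb{R}^{n\times n}\to\mathbb{R}$ are convex continuous, and $g_r:\mathbb{R}^{n\times n}\to\mathbb{R}^{p\times p}$ are continuous and convex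 (with respect to $\preceq$). A Slater point of such a set is a point $\bar\Delta$ of the set with $h_\ell(\bar\Delta)<0$ for all $\ell$ and $g_r(\bar\Delta)\prec 0_{p\times p}$ for all $r$; a common Slater point is one point that is a Slater point of every $\mathcal{Z}_i$.
   Formalization: In (iv), false as stated, the first case assumes that zeroing entries where L vanishes sends the set U into the closure of its matrices already zero there; the second assumes Z nonempty. In (v), (vii) a sum with both infinities is read as minus infinity. *)

theory Defs
  imports "Jordan_Normal_Form.Matrix" "HOL-Analysis.Analysis"
begin

text \<open>
  Matrices of one fixed size are elements of \<open>real^'n^'m\<close> (\<open>m\<close> rows, \<open>n\<close> columns).  Where the size
  varies with an index inside a formula, the type \<open>real mat\<close> with its carriers is used instead.
  Its infix notations that coincide with those for \<open>real^'n\<close> are switched off.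
\<close>

no_notation vec_index (infixl "$" 100)
no_notation scalar_prod (infix "\<bullet>" 70)

definition support_vec :: "(real^'d) set \<Rightarrow> real^'d \<Rightarrow> ereal"
  where "support_vec Z u = (SUP b\<in>Z. ereal (u \<bullet> b))"

definition support_mat :: "(real^'n^'m) set \<Rightarrow> real^'n^'m \<Rightarrow> ereal"
  where "support_mat Z U = (SUP \<Delta>\<in>Z. ereal (trace (\<Delta> ** transpose U)))"

text \<open>
  The components of a vector in \<open>\<real>\<^bsup>n\<^sup>2\<^esup>\<close> are indexed by the positions \<open>(i, j)\<close>, whose
  lexicographic order is the row-by-row order.
\<close>

definition vec_rows :: "real^'n^'n \<Rightarrow> real^('n \<times> 'n)"
  where "vec_rows A = (\<chi> ij. A $ fst ij $ snd ij)"

definition hadamard :: "real^'n^'m \<Rightarrow> real^'n^'m \<Rightarrow> real^'n^'m"  (infixl "\<circ>\<^sub>H" 70)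
  where "A \<circ>\<^sub>H B = (\<chi> i j. A $ i $ j * B $ i $ j)"

definition entry_inverse :: "real^'n^'m \<Rightarrow> real^'n^'m"
  where "entry_inverse L = (\<chi> i j. if L $ i $ j \<noteq> 0 then 1 / L $ i $ j else 0)"

text \<open>
  \<open>L \<circ>\<^sub>H entry_inverse L \<circ>\<^sub>H M\<close> is \<open>M\<close> with the entries at the zeros of \<open>L\<close> replaced by \<open>0\<close>.
  The set of all \<open>\<Delta>\<close> with \<open>L \<circ>\<^sub>H \<Delta> \<in> S\<close> only depends on the part of \<open>S\<close> in the range of
  \<open>L \<circ>\<^sub>H _\<close>, whereas the support function of \<open>S\<close> at \<open>U \<circ>\<^sub>H entry_inverse L\<close> only depends on the
  projection of \<open>S\<close> to that range.  The condition says that these two agree up to closure; for convex \<open>S\<close>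
  it is necessary for the two support functions to be equal at all \<open>U\<close> that vanish at the zeros of \<open>L\<close>.
  It holds if \<open>L\<close> has no zero entry or if \<open>S\<close> is contained in the range.  It fails, e.g., for
  \<open>L = (1 0; 1 1)\<close> and \<open>S = {M. \<bar>M\<^sub>1\<^sub>1\<bar> \<le> M\<^sub>1\<^sub>2 \<le> 1, M\<^sub>2\<^sub>1 = M\<^sub>2\<^sub>2 = 0}\<close>.
\<close>

definition pattern_compatible :: "real^'n^'m \<Rightarrow> (real^'n^'m) set \<Rightarrow> bool"
  where "pattern_compatible L S \<longleftrightarrow>
    (\<forall>M\<in>S. L \<circ>\<^sub>H entry_inverse L \<circ>\<^sub>H M \<in> closure (S \<inter> range (\<lambda>\<Delta>. L \<circ>\<^sub>H \<Delta>)))"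

text \<open>
  Sum of extended reals with the convention \<open>\<infinity> + (-\<infinity>) = -\<infinity>\<close>, whereas the addition of type
  \<open>ereal\<close> has \<open>\<infinity> + (-\<infinity>) = \<infinity>\<close>.  The two differ only where both infinities
  occur among the summands (lemma \<open>lower_sum_eq_sum\<close>), which for support functions
  means that one of the sets is empty and another one is unbounded.
\<close>

definition lower_sum :: "('i \<Rightarrow> ereal) \<Rightarrow> 'i set \<Rightarrow> ereal"
  where "lower_sum f A = - (\<Sum>i\<in>A. - f i)"

definition psd_mat :: "nat \<Rightarrow> real mat \<Rightarrow> bool"
  where "psd_mat p M \<longleftrightarrow> M \<in> carrier_mat p p \<and> transpose_mat M = M \<and>
    (\<forall>v\<in>carrier_vec p. 0 \<le> scalar_prod v (M *\<^sub>v v))"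

definition pd_mat :: "nat \<Rightarrow> real mat \<Rightarrow> bool"
  where "pd_mat p M \<longleftrightarrow> M \<in> carrier_mat p p \<and> transpose_mat M = M \<and>
    (\<forall>v\<in>carrier_vec p. v \<noteq> 0\<^sub>v p \<longrightarrow> 0 < scalar_prod v (M *\<^sub>v v))"

definition loewner_le :: "nat \<Rightarrow> real mat \<Rightarrow> real mat \<Rightarrow> bool"
  where "loewner_le p M N \<longleftrightarrow> psd_mat p (N - M)"

definition loewner_less :: "nat \<Rightarrow> real mat \<Rightarrow> real mat \<Rightarrow> bool"
  where "loewner_less p M N \<longleftrightarrow> pd_mat p (N - M)"

definition loewner_convex :: "nat \<Rightarrow> (real^'n^'n \<Rightarrow> real mat) \<Rightarrow> bool"
  where "loewner_convex p g \<longleftrightarrow> (\<forall>X Y. \<forall>t\<in>{0..1}.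
    loewner_le p (g ((1 - t) *\<^sub>R X + t *\<^sub>R Y)) ((1 - t) \<cdot>\<^sub>m g X + t \<cdot>\<^sub>m g Y))"

definition entrywise_continuous :: "nat \<Rightarrow> (real^'n^'n \<Rightarrow> real mat) \<Rightarrow> bool"
  where "entrywise_continuous p g \<longleftrightarrow>
    (\<forall>a<p. \<forall>b<p. continuous_on UNIV (\<lambda>X. g X $$ (a, b)))"

definition constraint_set ::
  "nat \<Rightarrow> (nat \<Rightarrow> real^'n^'n) \<Rightarrow> (nat \<Rightarrow> real) \<Rightarrow>
   nat \<Rightarrow> (nat \<Rightarrow> real^'n^'n \<Rightarrow> real) \<Rightarrow>
   nat \<Rightarrow> nat \<Rightarrow> (nat \<Rightarrow> real^'n^'n \<Rightarrow> real mat) \<Rightarrow> (real^'n^'n) set"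
  where "constraint_set I C q L h K p g =
    {\<Delta>. (\<forall>j\<in>{1..I}. trace (transpose (C j) ** \<Delta>) + q j = 0) \<and>
        (\<forall>l\<in>{1..L}. h l \<Delta> \<le> 0) \<and>
        (\<forall>r\<in>{1..K}. loewner_le p (g r \<Delta>) (0\<^sub>m p p))}"

definition constraint_data ::
  "nat \<Rightarrow> (nat \<Rightarrow> real^'n^'n \<Rightarrow> real) \<Rightarrow>
   nat \<Rightarrow> nat \<Rightarrow> (nat \<Rightarrow> real^'n^'n \<Rightarrow> real mat) \<Rightarrow> bool"
  where "constraint_data L h K p g \<longleftrightarrow> 0 < p \<and>
    (\<forall>l\<in>{1..L}. convex_on UNIV (h l) \<and> continuous_on UNIV (h l)) \<and>
    (\<forall>r\<in>{1..K}. (\<forall>\<Delta>. g r \<Delta> \<in> carrier_mat p p) \<and>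
      entrywise_continuous p (g r) \<and> loewner_convex p (g r))"

definition slater_point ::
  "nat \<Rightarrow> (nat \<Rightarrow> real^'n^'n) \<Rightarrow> (nat \<Rightarrow> real) \<Rightarrow>
   nat \<Rightarrow> (nat \<Rightarrow> real^'n^'n \<Rightarrow> real) \<Rightarrow>
   nat \<Rightarrow> nat \<Rightarrow> (nat \<Rightarrow> real^'n^'n \<Rightarrow> real mat) \<Rightarrow> real^'n^'n \<Rightarrow> bool"
  where "slater_point I C q L h K p g \<Delta> \<longleftrightarrow>
    \<Delta> \<in> constraint_set I C q L h K p g \<and>
    (\<forall>l\<in>{1..L}. h l \<Delta> < 0) \<and>
    (\<forall>r\<in>{1..K}. loewner_less p (g r \<Delta>) (0\<^sub>m p p))"

definition trace_mat :: "real mat \<Rightarrow> real"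
  where "trace_mat M = (\<Sum>a<dim_row M. M $$ (a, a))"

definition convex_mats :: "real mat set \<Rightarrow> bool"
  where "convex_mats Z \<longleftrightarrow>
    (\<forall>X\<in>Z. \<forall>Y\<in>Z. \<forall>t\<in>{0..1}. (1 - t) \<cdot>\<^sub>m X + t \<cdot>\<^sub>m Y \<in> Z)"

definition support_var_mat :: "real mat set \<Rightarrow> real mat \<Rightarrow> ereal"
  where "support_var_mat Z U = (SUP \<Delta>\<in>Z. ereal (trace_mat (\<Delta> * transpose_mat U)))"

definition support_tuple :: "('k::finite \<Rightarrow> real mat) set \<Rightarrow> ('k \<Rightarrow> real mat) \<Rightarrow> ereal"
  where "support_tuple Z U =
    (SUP \<Delta>\<in>Z. ereal (\<Sum>i\<in>UNIV. trace_mat (\<Delta> i * transpose_mat (U i))))"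

lemma trace_vec_rows: "trace (A ** transpose B) = vec_rows A \<bullet> vec_rows B"
  by (simp add: trace_def matrix_matrix_mult_def transpose_def vec_rows_def inner_vec_def
      sum.cartesian_product UNIV_Times_UNIV[symmetric] case_prod_unfold del: UNIV_Times_UNIV)

lemma sum_ereal_neq_MInf:
  assumes "finite A" "\<forall>i\<in>A. f i \<noteq> (-\<infinity> :: ereal)"
  shows "(\<Sum>i\<in>A. f i) \<noteq> -\<infinity>"
  using assms by (induction A rule: finite_induct) auto

lemma lower_sum_eq_sum:
  assumes "(\<forall>i\<in>A. f i \<noteq> \<infinity>) \<or> (\<forall>i\<in>A. f i \<noteq> -\<infinity>)"
  shows "lower_sum f A = (\<Sum>i\<in>A. f i)"
proof (cases "finite A")
  case True
  then show ?thesis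
    using assms
  proof (induction A rule: finite_induct)
    case empty
    then show ?case by (simp add: lower_sum_def)
  next
    case (insert x A)
    have IH: "- (\<Sum>i\<in>A. - f i) = (\<Sum>i\<in>A. f i)"
      using insert by (auto simp: lower_sum_def)
    have S: "(\<Sum>i\<in>A. - f i) = - (\<Sum>i\<in>A. f i)"
      using IH by (metis ereal_uminus_uminus)
    have "(f x \<noteq> \<infinity> \<and> (\<Sum>i\<in>A. f i) \<noteq> \<infinity>) \<or> (f x \<noteq> -\<infinity> \<and> (\<Sum>i\<in>A. f i) \<noteq> -\<infinity>)"
      using insert.prems insert.hyps sum_ereal_neq_MInf[of A f] by (auto simp: sum_Pinfty)
    then have "- (- f x + - (\<Sum>i\<in>A. f i)) = f x + (\<Sum>i\<in>A. f i)"
      by (cases "f x"; cases "\<Sum>i\<in>A. f i") auto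
    then show ?case
      using insert.hyps by (simp add: lower_sum_def S)
  qed
qed (simp add: lower_sum_def)

end

theory Submission
  imports Defs
begin

text \<open>
  Parts (i)--(iii) and the first case of (iv) move a linear map across the inner product, and parts
  (v), (vii) and (viii) split a supremum.

  For (vi), a Slater point \<open>z\<close> is a relative interior point of each \<open>Z\<^sub>i\<close>: by continuity and the openness of
  positive definiteness, every segment from a point of \<open>Z\<^sub>i\<close> to \<open>z\<close> can be prolonged beyond \<open>z\<close>.
  Now let \<open>s\<close> be the supremum of \<open>\<langle>U, y\<rangle>\<close> over the intersection, and consider the hypograph of the
  perturbation function \<open>d \<mapsto> sup {\<langle>U, y\<rangle> - s | y + d\<^sub>i \<in> Z\<^sub>i for all i}\<close>, a convex set with
  \<open>(0, 0)\<close> on its relative boundary.  A supporting hyperplane at \<open>(0, 0)\<close> that does not contain the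
  whole hypograph is not vertical, since \<open>0\<close> is a relative interior point of the domain.  Its slope
  consists of matrices \<open>-V\<^sub>i\<close>; as \<open>y\<close> is unrestricted, they satisfy \<open>\<Sum>V\<^sub>i = U\<close> and
  \<open>\<Sum>\<langle>V\<^sub>i, x\<^sub>i\<rangle> \<le> s\<close> for all \<open>x\<^sub>i \<in> Z\<^sub>i\<close>.
\<close>

section \<open>Trace pairing as inner product, and sums of suprema\<close>

lemma trace_transpose_eq_inner: "trace (A ** transpose B) = A \<bullet> (B :: real^'n^'m)"
  by (simp add: trace_def matrix_matrix_mult_def transpose_def inner_vec_def)

lemma support_mat_inner: "support_mat Z U = (SUP \<Delta>\<in>Z. ereal (\<Delta> \<bullet> U))"
  by (simp add: support_mat_def trace_transpose_eq_inner)

lemma lower_sum_MInf: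
  assumes "finite A" "i \<in> A" "f i = -\<infinity>"
  shows "lower_sum f A = -\<infinity>"
  using assms by (force simp: lower_sum_def sum_Pinfty)

text \<open>An empty \<open>Z i\<close> leaves no admissible family, so the right side is
  \<open>-\<infinity>\<close>; on the left \<open>-\<infinity>\<close> must then win against a
  possible \<open>\<infinity>\<close>, which is what \<open>lower_sum\<close> provides. If all sets
  are nonempty, no summand is \<open>-\<infinity>\<close>, ordinary addition is meant, and
  near-maximisers can be chosen independently in each coordinate.\<close>

lemma lower_sum_SUP:
  fixes f :: "'k::finite \<Rightarrow> 'a \<Rightarrow> real"
  shows "lower_sum (\<lambda>i. SUP x\<in>Z i. ereal (f i x)) UNIV =
    (SUP x\<in>{x. \<forall>i. x i \<in> Z i}. ereal (\<Sum>i\<in>UNIV. f i (x i)))" (is "_ = ?R")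
proof (cases "\<exists>i. Z i = {}")
  case True
  then obtain i where i: "Z i = {}" ..
  then have "{x. \<forall>i. x i \<in> Z i} = {}"
    by blast
  then have "?R = -\<infinity>"
    by (simp only: image_empty Sup_empty bot_ereal_def)
  moreover have "lower_sum (\<lambda>i. SUP x\<in>Z i. ereal (f i x)) UNIV = -\<infinity>"
    by (rule lower_sum_MInf[of _ i]) (simp_all add: i bot_ereal_def)
  ultimately show ?thesis
    by simp
next
  case False
  then have "\<forall>i. \<exists>x. x \<in> Z i"
    by blast
  then obtain x0 where x0: "\<And>i. x0 i \<in> Z i"
    by metis
  let ?s = "\<lambda>i. SUP x\<in>Z i. ereal (f i x)"
  have s_upper: "ereal (f i x) \<le> ?s i" if "x \<in> Z i" for i x
    using that by (rule SUP_upper)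
  have nMInf: "?s i \<noteq> -\<infinity>" for i
    using s_upper[OF x0, of i] by auto
  have "(\<Sum>i\<in>UNIV. ?s i) = ?R"
  proof (rule antisym)
    show "?R \<le> (\<Sum>i\<in>UNIV. ?s i)"
      using s_upper by (auto intro!: SUP_least sum_mono simp flip: sum_ereal)
    show "(\<Sum>i\<in>UNIV. ?s i) \<le> ?R"
    proof (cases ?R)
      case (real B)
      have B: "(\<Sum>i\<in>UNIV. f i (x i)) \<le> B" if "\<And>i. x i \<in> Z i" for x
      proof -
        have "ereal (\<Sum>i\<in>UNIV. f i (x i)) \<le> ?R"
          using that by (intro SUP_upper) auto
        with real show ?thesis
          by simp
      qed
      \<comment> \<open>Freezing all other coordinates at \<open>x0\<close> turns the joint bound
        \<open>B\<close> into a bound for coordinate \<open>i\<close> alone.\<close>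
      have "?s i \<noteq> \<infinity>" for i
      proof -
        have "f i y \<le> B - (\<Sum>j\<in>UNIV - {i}. f j (x0 j))" if "y \<in> Z i" for y
        proof -
          have "(\<Sum>j\<in>UNIV. f j ((x0(i := y)) j)) \<le> B"
            using that x0 by (intro B) auto
          moreover have "(\<Sum>j\<in>UNIV. f j ((x0(i := y)) j))
              = f i y + (\<Sum>j\<in>UNIV - {i}. f j (x0 j))"
            by (subst sum.remove[of _ i]) auto
          ultimately show ?thesis
            by linarith
        qed
        then have "?s i \<le> ereal (B - (\<Sum>j\<in>UNIV - {i}. f j (x0 j)))"
          by (intro SUP_least) auto
        then show ?thesis
          by auto
      qed
      then have "\<exists>c. ?s i = ereal c" for i
        using nMInf[of i] by (cases "?s i") auto
      then obtain c where c: "\<And>i. ?s i = ereal (c i)"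
        by metis
      have "(\<Sum>i\<in>UNIV. c i) \<le> B"
      proof (rule field_le_epsilon)
        fix e :: real assume "e > 0"
        \<comment> \<open>The tolerance \<open>e\<close> is split evenly over the indices.\<close>
        define \<epsilon> where "\<epsilon> = e / CARD('k)"
        have \<epsilon>: "\<epsilon> > 0"
          using \<open>e > 0\<close> by (simp add: \<epsilon>_def)
        have "\<exists>x\<in>Z i. c i - \<epsilon> < f i x" for i
        proof -
          have "ereal (c i - \<epsilon>) < ?s i"
            using c \<epsilon> by simp
          then show ?thesis
            by (auto simp: less_SUP_iff)
        qed
        then obtain x where x: "\<And>i. x i \<in> Z i" "\<And>i. c i - \<epsilon> < f i (x i)"
          by metis
        have "(\<Sum>i\<in>UNIV. c i) \<le> (\<Sum>i\<in>UNIV. f i (x i) + \<epsilon>)"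
          using x(2) by (intro sum_mono) (simp add: less_imp_le algebra_simps)
        also have "\<dots> = (\<Sum>i\<in>UNIV. f i (x i)) + e"
          by (simp add: sum.distrib \<epsilon>_def)
        also have "\<dots> \<le> B + e"
          using B[OF x(1)] by simp
        finally show "(\<Sum>i\<in>UNIV. c i) \<le> B + e" .
      qed
      then show ?thesis
        by (simp add: c real)
    next
      case MInf
      have "ereal (\<Sum>i\<in>UNIV. f i (x0 i)) \<le> ?R"
        using x0 by (intro SUP_upper) auto
      with MInf show ?thesis
        by simp
    qed simp
  qed
  moreover have "lower_sum ?s UNIV = (\<Sum>i\<in>UNIV. ?s i)"
    using nMInf by (intro lower_sum_eq_sum) simp
  ultimately show ?thesis
    by simp
qed

section \<open>Images and preimages under linear maps\<close>

text \<open>\<open>vec_rows\<close> is onto, so the preimage of \<open>S\<close> is mapped onto all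
  of \<open>S\<close>, and it preserves the pairing.\<close>

lemma support_mat_vec_rows_vimage:
  "support_mat {\<Delta>. vec_rows \<Delta> \<in> S} U = support_vec S (vec_rows U)"
proof -
  have "b = vec_rows (\<chi> i j. b $ (i, j))" for b
    by (simp add: vec_rows_def vec_eq_iff)
  then have "surj vec_rows"
    by (rule surjI[OF sym])
  then have "S = vec_rows ` {\<Delta>. vec_rows \<Delta> \<in> S}"
    by (metis surj_image_vimage_eq vimage_def)
  then have "support_vec S (vec_rows U) = (SUP \<Delta>\<in>{\<Delta>. vec_rows \<Delta> \<in> S}. ereal (vec_rows U \<bullet> vec_rows \<Delta>))"
    unfolding support_vec_def by (metis image_image)
  then show ?thesis
    by (simp add: support_mat_def trace_vec_rows inner_commute)
qed

lemma support_mat_linear_combinations: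
  fixes D :: "'k::finite \<Rightarrow> real^'n^'m"
  shows "support_mat {(\<Sum>i\<in>UNIV. \<zeta> $ i *\<^sub>R D i) | \<zeta>. \<zeta> \<in> S} U =
    support_vec S (\<chi> i. trace (D i ** transpose U))"
  unfolding support_mat_inner support_vec_def trace_transpose_eq_inner
  by (simp add: Setcompr_eq_image image_image inner_sum_left inner_vec_def[where 'b = 'k] mult.commute)

text \<open>By cyclicity of the trace: the adjoint of multiplication from the left.\<close>

lemma inner_matrix_mult_left: "(A ** B) \<bullet> C = B \<bullet> (transpose A ** (C :: real^'n^'m))"
  unfolding trace_transpose_eq_inner[symmetric]
  by (simp add: matrix_transpose_mul matrix_mul_assoc)
    (metis trace_mul_sym matrix_mul_assoc)

lemma inner_matrix_mult_right: "(A ** B) \<bullet> C = A \<bullet> ((C :: real^'n^'m) ** transpose B)"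
  unfolding trace_transpose_eq_inner[symmetric]
  by (simp add: matrix_transpose_mul matrix_mul_assoc)

lemma support_mat_mult:
  fixes L :: "real^'t^'m" and R :: "real^'n^'s"
  shows "support_mat {L ** \<Delta> ** R | \<Delta>. \<Delta> \<in> S} U = support_mat S (transpose L ** U ** transpose R)"
  unfolding support_mat_inner
  by (simp add: Setcompr_eq_image image_image inner_matrix_mult_right[of _ R]
      inner_matrix_mult_left[of L] matrix_mul_assoc)

text \<open>The sublevel set of \<open>f\<close> at the supremum over \<open>S\<close> is closed and
  therefore already contains the closure.\<close>

lemma SUP_closure_continuous:
  fixes f :: "'a::topological_space \<Rightarrow> real"
  assumes "continuous_on UNIV f"
  shows "(SUP x\<in>closure S. ereal (f x)) = (SUP x\<in>S. ereal (f x))" (is "_ = ?s")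
proof (rule antisym)
  have "closed {x. ereal (f x) \<le> ?s}"
    using assms by (intro closed_Collect_le continuous_intros)
  then have "closure S \<subseteq> {x. ereal (f x) \<le> ?s}"
    by (intro closure_minimal) (auto intro: SUP_upper)
  then show "(SUP x\<in>closure S. ereal (f x)) \<le> ?s"
    by (intro SUP_least) auto
qed (rule SUP_subset_mono[OF closure_subset order_refl])

lemma inner_hadamard_entry_inverse:
  fixes U :: "real^'n^'m"
  assumes "\<And>i j. L $ i $ j = 0 \<Longrightarrow> U $ i $ j = 0"
  shows "(L \<circ>\<^sub>H \<Delta>) \<bullet> (U \<circ>\<^sub>H entry_inverse L) = \<Delta> \<bullet> U"
  unfolding inner_vec_def hadamard_def entry_inverse_def using assms
  by (auto intro!: sum.cong)

text \<open>The left side is a supremum over the part \<open>?R\<close> of \<open>S\<close> in the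
  range of the masking map. To compare it with all of \<open>S\<close>, mask a given
  \<open>M\<close>: the pairing with \<open>?W\<close> is unchanged because \<open>?W\<close>
  vanishes at the zeros of \<open>L\<close>, and the masked matrix lies in the closure of
  \<open>?R\<close>, where the supremum is the same.\<close>

lemma support_mat_hadamard_vimage:
  fixes L U :: "real^'n^'m"
  assumes "pattern_compatible L S" and U: "\<And>i j. L $ i $ j = 0 \<Longrightarrow> U $ i $ j = 0"
  shows "support_mat {\<Delta>. L \<circ>\<^sub>H \<Delta> \<in> S} U = support_mat S (U \<circ>\<^sub>H entry_inverse L)"
proof -
  let ?W = "U \<circ>\<^sub>H entry_inverse L" and ?R = "S \<inter> range (\<lambda>\<Delta>. L \<circ>\<^sub>H \<Delta>)"
  have "?R = (\<lambda>\<Delta>. L \<circ>\<^sub>H \<Delta>) ` {\<Delta>. L \<circ>\<^sub>H \<Delta> \<in> S}"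
    by auto
  then have "support_mat {\<Delta>. L \<circ>\<^sub>H \<Delta> \<in> S} U = (SUP M\<in>?R. ereal (M \<bullet> ?W))"
    unfolding support_mat_inner by (simp add: image_image inner_hadamard_entry_inverse[OF U])
  also have "\<dots> = support_mat S ?W"
  proof (rule antisym)
    show "(SUP M\<in>?R. ereal (M \<bullet> ?W)) \<le> support_mat S ?W"
      unfolding support_mat_inner by (rule SUP_subset_mono) auto
    have "ereal (M \<bullet> ?W) \<le> (SUP M\<in>closure ?R. ereal (M \<bullet> ?W))" if "M \<in> S" for M
    proof -
      have "L \<circ>\<^sub>H entry_inverse L \<circ>\<^sub>H M \<in> closure ?R"
        using assms(1) that by (auto simp: pattern_compatible_def)
      moreover have "(L \<circ>\<^sub>H entry_inverse L \<circ>\<^sub>H M) \<bullet> ?W = M \<bullet> ?W"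
        by (auto simp: inner_vec_def hadamard_def entry_inverse_def intro!: sum.cong)
      ultimately show ?thesis
        by (metis (mono_tags, lifting) SUP_upper)
    qed
    then have "support_mat S ?W \<le> (SUP M\<in>closure ?R. ereal (M \<bullet> ?W))"
      unfolding support_mat_inner by (rule SUP_least)
    also have "\<dots> = (SUP M\<in>?R. ereal (M \<bullet> ?W))"
      by (intro SUP_closure_continuous continuous_intros)
    finally show "support_mat S ?W \<le> (SUP M\<in>?R. ereal (M \<bullet> ?W))" .
  qed
  finally show ?thesis .
qed

lemma support_mat_hadamard_vimage_infinite:
  fixes L U :: "real^'n^'m"
  assumes "{\<Delta>. L \<circ>\<^sub>H \<Delta> \<in> S} \<noteq> {}" and ij: "L $ i $ j = 0" "U $ i $ j \<noteq> 0"
  shows "support_mat {\<Delta>. L \<circ>\<^sub>H \<Delta> \<in> S} U = \<infinity>"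
proof -
  obtain X where X: "L \<circ>\<^sub>H X \<in> S"
    using assms(1) by auto
  have "ereal B \<le> support_mat {\<Delta>. L \<circ>\<^sub>H \<Delta> \<in> S} U" for B
  proof -
    \<comment> \<open>The entry at \<open>(i, j)\<close> is unconstrained, as \<open>L\<close>
      multiplies it by 0; it is shifted by the amount that makes the pairing with \<open>U\<close>
      exactly \<open>B\<close>.\<close>
    define c where "c = (B - X \<bullet> U) / U $ i $ j"
    define E :: "real^'n^'m" where "E = axis i (axis j c)"
    have "L \<circ>\<^sub>H (X + E) = L \<circ>\<^sub>H X"
      using ij(1) by (auto simp: hadamard_def E_def axis_def vec_eq_iff)
    moreover have "(X + E) \<bullet> U = B"
      using ij(2) by (simp add: inner_add_left E_def inner_axis' c_def)
    ultimately show ?thesis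
      unfolding support_mat_inner using X by (intro SUP_upper2[of "X + E"]) auto
  qed
  then show ?thesis
    by (rule ereal_top)
qed

section \<open>Minkowski sums, tuples and convex hulls\<close>

lemma support_mat_sum:
  fixes Z :: "'k::finite \<Rightarrow> (real^'n^'m) set"
  shows "support_mat (\<Sum>i\<in>UNIV. Z i) U = lower_sum (\<lambda>i. support_mat (Z i) U) UNIV"
proof -
  have "(\<Sum>i\<in>UNIV. Z i) = (\<lambda>x. \<Sum>i\<in>UNIV. x i) ` {x. \<forall>i. x i \<in> Z i}"
    by (auto simp: set_sum_alt)
  then show ?thesis
    unfolding support_mat_inner lower_sum_SUP by (simp add: image_image inner_sum_left)
qed

lemma support_tuple_Pi:
  "support_tuple {\<Delta>. \<forall>i. \<Delta> i \<in> Z i} W = lower_sum (\<lambda>i. support_var_mat (Z i) (W i)) UNIV"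
  unfolding support_tuple_def support_var_mat_def lower_sum_SUP ..

text \<open>The points whose pairing with \<open>U\<close> stays below the supremum form a
  halfspace, the whole space or the empty set, hence a convex set containing
  \<open>S\<close>.\<close>

lemma support_mat_convex_hull: "support_mat (convex hull S) U = support_mat S U"
proof (rule antisym)
  let ?H = "{\<Delta>. ereal (\<Delta> \<bullet> U) \<le> support_mat S U}"
  have "convex ?H"
    by (cases "support_mat S U")
      (simp_all add: inner_commute[of _ U] convex_halfspace_le)
  moreover have "S \<subseteq> ?H"
    by (auto simp: support_mat_inner intro: SUP_upper)
  ultimately have "convex hull S \<subseteq> ?H"
    by (intro hull_minimal)
  then show "support_mat (convex hull S) U \<le> support_mat S U"
    unfolding support_mat_inner[of "convex hull S"] by (intro SUP_least) auto
  show "support_mat S U \<le> support_mat (convex hull S) U"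
    unfolding support_mat_def by (intro SUP_subset_mono hull_subset order_refl)
qed

lemma support_mat_convex_hull_UN:
  fixes Z :: "'k::finite \<Rightarrow> (real^'n^'m) set"
  shows "support_mat (convex hull (\<Union>i. Z i)) U = Max (range (\<lambda>i. support_mat (Z i) U))"
  unfolding support_mat_convex_hull
  by (subst Max_Sup) (simp_all add: support_mat_def SUP_UNION)

section \<open>Splitting a functional over an intersection by separation\<close>

text \<open>Each segment can be prolonged beyond \<open>z\<close> by a length of its own. As there
  are finitely many, the least length is positive, and by convexity it serves all of them. A common
  \<open>\<epsilon>\<close> is needed to reverse a whole tuple of perturbations at once.\<close>

lemma rel_interior_common_extrapolation:
  fixes Z :: "'k::finite \<Rightarrow> 'a::euclidean_space set"
  assumes conv: "\<And>i. convex (Z i)" and z: "\<And>i. z \<in> rel_interior (Z i)" and x: "\<And>i. x i \<in> Z i"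
  obtains \<epsilon> where "\<epsilon> > 0" "\<And>i. z + \<epsilon> *\<^sub>R (z - x i) \<in> Z i"
proof -
  have "\<exists>e>1. (1 - e) *\<^sub>R x i + e *\<^sub>R z \<in> Z i" for i
    using convex_rel_interior_iff[OF conv, of i z] z x by blast
  then obtain e where e: "\<And>i. e i > 1" "\<And>i. (1 - e i) *\<^sub>R x i + e i *\<^sub>R z \<in> Z i"
    by metis
  define \<epsilon> where "\<epsilon> = Min (range (\<lambda>i. e i - 1))"
  have pos: "\<epsilon> > 0"
    unfolding \<epsilon>_def using e(1) by (subst Min_gr_iff) auto
  have "z + \<epsilon> *\<^sub>R (z - x i) \<in> Z i" for i
  proof -
    have le: "\<epsilon> \<le> e i - 1"
      unfolding \<epsilon>_def by (rule Min_le) auto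
    \<comment> \<open>The fraction of the way from \<open>z\<close> to the \<open>i\<close>-th
      prolonged point at which the step length is \<open>\<epsilon>\<close>.\<close>
    define t where "t = \<epsilon> / (e i - 1)"
    have t: "0 \<le> t" "t \<le> 1" "t * (e i - 1) = \<epsilon>"
      using pos le e(1)[of i] by (auto simp: t_def)
    have "(1 - t) *\<^sub>R z + t *\<^sub>R ((1 - e i) *\<^sub>R x i + e i *\<^sub>R z) \<in> Z i"
      using convexD_alt[OF conv _ e(2)] t z rel_interior_subset by blast
    moreover have "(1 - t) *\<^sub>R z + t *\<^sub>R ((1 - e i) *\<^sub>R x i + e i *\<^sub>R z)
        = z + (t * (e i - 1)) *\<^sub>R (z - x i)"
      by (simp add: algebra_simps)
    ultimately show ?thesis
      using t by simp
  qed
  with pos show thesis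
    using that by blast
qed

lemma linear_bounded_above_zero:
  fixes w :: "'a::real_inner"
  assumes "\<And>y. y \<bullet> w \<le> c"
  shows "w = 0"
proof (rule ccontr)
  assume "w \<noteq> 0"
  then have "(((c + 1) / (w \<bullet> w)) *\<^sub>R w) \<bullet> w = c + 1"
    by simp
  with assms[of "((c + 1) / (w \<bullet> w)) *\<^sub>R w"] show False
    by linarith
qed

lemma support_Inter_decomposition:
  fixes Z :: "'k::finite \<Rightarrow> 'a::euclidean_space set"
  assumes conv: "\<And>i. convex (Z i)" and z: "\<And>i. z \<in> rel_interior (Z i)"
    and bd: "\<And>y. y \<in> (\<Inter>i. Z i) \<Longrightarrow> y \<bullet> u \<le> s"
  obtains V where "(\<Sum>i\<in>UNIV. V i) = u"
    and "\<And>x. (\<And>i. x i \<in> Z i) \<Longrightarrow> (\<Sum>i\<in>UNIV. x i \<bullet> V i) \<le> s"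
proof -
  have zZ: "z \<in> Z i" for i
    using z rel_interior_subset by blast
  define B where "B = (\<lambda>y. y \<bullet> u) ` (\<Inter>i. Z i)"
  \<comment> \<open>The exact supremum replaces the bound \<open>s\<close>, so that the origin is a
    limit of points of the hypograph \<open>T\<close>.\<close>
  define m where "m = Sup B"
  have B: "B \<noteq> {}" "bdd_above B"
    using zZ bd by (auto simp: B_def intro!: bdd_aboveI[of _ s])
  have ms: "m \<le> s"
    unfolding m_def using B bd by (intro cSup_least) (auto simp: B_def)
  have le_m: "y \<bullet> u \<le> m" if "\<And>i. y \<in> Z i" for y
    unfolding m_def using that B by (intro cSup_upper) (auto simp: B_def)
  define T :: "(('a^'k) \<times> real) set"
    where "T = {(d, t). \<exists>y. (\<forall>i. y + d $ i \<in> Z i) \<and> t \<le> y \<bullet> u - m}"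
  have convT: "convex T"
  proof (rule convexI)
    fix p q :: "('a^'k) \<times> real" and a b :: real
    assume pq: "p \<in> T" "q \<in> T" and ab: "0 \<le> a" "0 \<le> b" "a + b = 1"
    obtain y1 where y1: "\<And>i. y1 + fst p $ i \<in> Z i" "snd p \<le> y1 \<bullet> u - m"
      using pq(1) unfolding T_def case_prod_unfold by blast
    obtain y2 where y2: "\<And>i. y2 + fst q $ i \<in> Z i" "snd q \<le> y2 \<bullet> u - m"
      using pq(2) unfolding T_def case_prod_unfold by blast
    have "(a *\<^sub>R y1 + b *\<^sub>R y2) + fst (a *\<^sub>R p + b *\<^sub>R q) $ i \<in> Z i" for i
      using convexD[OF conv y1(1) y2(1) ab, of i] by (simp add: algebra_simps)
    moreover have "snd (a *\<^sub>R p + b *\<^sub>R q) \<le> (a *\<^sub>R y1 + b *\<^sub>R y2) \<bullet> u - m"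
    proof -
      have "a * snd p + b * snd q \<le> a * (y1 \<bullet> u - m) + b * (y2 \<bullet> u - m)"
        using y1(2) y2(2) ab by (intro add_mono mult_left_mono)
      also have "\<dots> = a * (y1 \<bullet> u) + b * (y2 \<bullet> u) - (a + b) * m"
        by (simp add: algebra_simps)
      finally show ?thesis
        using ab by (simp add: inner_add_left)
    qed
    ultimately show "a *\<^sub>R p + b *\<^sub>R q \<in> T"
      unfolding T_def by (auto simp: case_prod_unfold)
  qed
  have pT: "(0, z \<bullet> u - m - 1) \<in> T"
    using zZ by (auto simp: T_def intro!: exI[of _ z])
  have neg: "z \<bullet> u - m - 1 < 0"
    using le_m[OF zZ] by simp
  have cl: "(0, 0) \<in> closure T"
    unfolding closure_approachable
  proof (intro allI impI)
    fix e :: real assume "e > 0"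
    then obtain y where y: "\<And>i. y \<in> Z i" "m - e < y \<bullet> u"
      using less_cSup_iff[OF B, of "m - e"] by (auto simp: m_def B_def)
    have "(0, y \<bullet> u - m) \<in> T"
      using y by (auto simp: T_def)
    moreover have "dist (0, y \<bullet> u - m) (0::'a^'k, 0::real) < e"
      using y(2) le_m[OF y(1)] by (simp add: dist_Pair_Pair dist_real_def)
    ultimately show "\<exists>y\<in>T. dist y (0, 0) < e"
      by blast
  qed
  \<comment> \<open>Prolonging the vertical segment from the point below the origin beyond the
    origin would give a point of \<open>T\<close> of positive height over \<open>d = 0\<close>, that
    is, a common point with value above \<open>m\<close>.\<close>
  have nri: "(0, 0) \<notin> rel_interior T"
  proof
    assume "(0, 0) \<in> rel_interior T"
    then obtain e where e: "e > 1"
      "(1 - e) *\<^sub>R (0, z \<bullet> u - m - 1) + e *\<^sub>R (0, 0) \<in> T"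
      using convex_rel_interior_iff[OF convT, of "(0, 0)"] pT by blast
    then obtain y where y: "\<And>i. y \<in> Z i" "(1 - e) * (z \<bullet> u - m - 1) \<le> y \<bullet> u - m"
      by (auto simp: T_def)
    moreover have "0 < (1 - e) * (z \<bullet> u - m - 1)"
      using e neg by (intro mult_neg_neg) auto
    ultimately show False
      using le_m[of y] by force
  qed
  obtain a where a: "\<And>p. p \<in> closure T \<Longrightarrow> a \<bullet> (0, 0) \<le> a \<bullet> p"
      "\<And>p. p \<in> rel_interior T \<Longrightarrow> a \<bullet> (0, 0) < a \<bullet> p"
    using supporting_hyperplane_relative_frontier[OF convT cl nri] by metis
  define \<alpha> \<beta> where "\<alpha> = fst a" and "\<beta> = snd a"
  have sep: "0 \<le> \<alpha> \<bullet> d + \<beta> * t" if "(d, t) \<in> T" for d t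
    using a(1)[of "(d, t)"] that closure_subset[of T]
    by (auto simp: \<alpha>_def \<beta>_def inner_prod_def)
  have "\<beta> \<le> 0"
    using sep[OF pT] neg by (simp add: zero_le_mult_iff)
  \<comment> \<open>If the hyperplane were vertical, strictness on the relative interior would give
    some \<open>d\<close> in the domain with \<open>\<alpha> \<bullet> d > 0\<close>, while a small
    multiple of \<open>- d\<close> also belongs to the domain and violates
    \<open>sep\<close>.\<close>
  moreover have "\<beta> \<noteq> 0"
  proof
    assume 0: "\<beta> = 0"
    have "rel_interior T \<noteq> {}"
      using rel_interior_eq_empty[OF convT] pT by blast
    then obtain d t where dt: "(d, t) \<in> rel_interior T"
      by auto
    then have dpos: "0 < \<alpha> \<bullet> d"
      using a(2)[OF dt] 0 by (auto simp: \<alpha>_def \<beta>_def inner_prod_def)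
    obtain y where y: "\<And>i. y + d $ i \<in> Z i"
      using dt rel_interior_subset[of T] by (auto simp: T_def)
    obtain \<epsilon> where \<epsilon>: "\<epsilon> > 0" "\<And>i. z + \<epsilon> *\<^sub>R (z - (y + d $ i)) \<in> Z i"
      using rel_interior_common_extrapolation[of Z z "\<lambda>i. y + d $ i", OF conv z y] by blast
    \<comment> \<open>The base point for which the shift by
      \<open>- \<epsilon> *\<^sub>R d $ i\<close> hits the prolongation, beyond \<open>z\<close>, of
      the segment starting at \<open>y + d $ i\<close>.\<close>
    define y' where "y' = z + \<epsilon> *\<^sub>R (z - y)"
    have "y' + (- \<epsilon> *\<^sub>R d) $ i = z + \<epsilon> *\<^sub>R (z - (y + d $ i))" for i
      by (simp add: y'_def algebra_simps)
    then have "y' + (- \<epsilon> *\<^sub>R d) $ i \<in> Z i" for i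
      using \<epsilon>(2) by simp
    then have "(- \<epsilon> *\<^sub>R d, y' \<bullet> u - m) \<in> T"
      unfolding T_def by blast
    from sep[OF this] have "\<epsilon> * (\<alpha> \<bullet> d) \<le> 0"
      using 0 by simp
    with dpos \<epsilon>(1) show False
      by (simp add: mult_le_0_iff)
  qed
  ultimately have \<beta>: "\<beta> < 0"
    by simp
  define V where "V = (\<lambda>i. (1 / \<beta>) *\<^sub>R \<alpha> $ i)"
  \<comment> \<open>The perturbation \<open>x i - y\<close> moves \<open>y\<close> to
    \<open>x i\<close>, so \<open>x\<close> and \<open>y\<close> can be chosen independently of each
    other; dividing by the negative \<open>\<beta>\<close> reverses the inequality.\<close>
  have key: "y \<bullet> (u - (\<Sum>i\<in>UNIV. V i)) + (\<Sum>i\<in>UNIV. x i \<bullet> V i) \<le> m"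
    if x: "\<And>i. x i \<in> Z i" for x y
  proof -
    have "((\<chi> i. x i - y), y \<bullet> u - m) \<in> T"
      using x by (auto simp: T_def intro!: exI[of _ y])
    from sep[OF this] have "0 \<le> (\<Sum>i\<in>UNIV. \<alpha> $ i \<bullet> (x i - y)) + \<beta> * (y \<bullet> u - m)"
      by (simp add: inner_vec_def)
    also have "(\<Sum>i\<in>UNIV. \<alpha> $ i \<bullet> (x i - y)) = \<beta> * (\<Sum>i\<in>UNIV. V i \<bullet> (x i - y))"
      using \<beta> by (simp add: V_def sum_distrib_left)
    finally have "0 \<le> \<beta> * ((\<Sum>i\<in>UNIV. V i \<bullet> (x i - y)) + (y \<bullet> u - m))"
      by (simp add: distrib_left)
    then have "(\<Sum>i\<in>UNIV. V i \<bullet> (x i - y)) + (y \<bullet> u - m) \<le> 0"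
      using \<beta> by (simp add: zero_le_mult_iff)
    then show ?thesis
      by (simp add: inner_diff_right inner_sum_right sum_subtractf inner_commute)
  qed
  \<comment> \<open>With \<open>x\<close> held at \<open>z\<close>, \<open>key\<close> bounds a
    linear functional of \<open>y\<close> from above, which forces it to be zero. Setting
    \<open>y = 0\<close> afterwards leaves the bound on the sum.\<close>
  have "u - (\<Sum>i\<in>UNIV. V i) = 0"
    by (rule linear_bounded_above_zero[of _ "m - (\<Sum>i\<in>UNIV. z \<bullet> V i)"])
      (use key[of "\<lambda>_. z"] zZ in \<open>simp add: algebra_simps\<close>)
  moreover from this have "(\<Sum>i\<in>UNIV. x i \<bullet> V i) \<le> s" if "\<And>i. x i \<in> Z i" for x
    using key[OF that, where y = 0] ms by simp
  ultimately show thesis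
    using that[of V] by simp
qed

section \<open>Openness of positive definiteness\<close>

text \<open>The argument is a function on \<open>nat\<close> instead of an element of
  \<open>carrier_vec p\<close>, so that the product topology on functions applies in the compactness
  argument.\<close>

definition quadratic_form :: "nat \<Rightarrow> real mat \<Rightarrow> (nat \<Rightarrow> real) \<Rightarrow> real"
  where "quadratic_form p M f = (\<Sum>a<p. \<Sum>b<p. f a * M $$ (a, b) * f b)"

lemma scalar_prod_mult_mat_vec:
  assumes "M \<in> carrier_mat p p" "v \<in> carrier_vec p"
  shows "scalar_prod v (M *\<^sub>v v) = quadratic_form p M (vec_index v)"
  using assms
  by (auto simp: scalar_prod_def quadratic_form_def sum_distrib_left mult.assoc
      atLeast0LessThan intro!: sum.cong)

lemma quadratic_form_cong:
  "(\<And>a. a < p \<Longrightarrow> f a = f' a) \<Longrightarrow> quadratic_form p M f = quadratic_form p M f'"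
  by (simp add: quadratic_form_def)

lemma psd_mat_iff:
  "psd_mat p M \<longleftrightarrow> M \<in> carrier_mat p p \<and> (\<forall>a<p. \<forall>b<p. M $$ (a, b) = M $$ (b, a)) \<and>
    (\<forall>f. 0 \<le> quadratic_form p M f)"
proof (cases "M \<in> carrier_mat p p")
  case M: True
  have sym: "transpose_mat M = M \<longleftrightarrow> (\<forall>a<p. \<forall>b<p. M $$ (a, b) = M $$ (b, a))"
    using M by (auto simp: mat_eq_iff)
  have "(\<forall>v\<in>carrier_vec p. 0 \<le> scalar_prod v (M *\<^sub>v v)) \<longleftrightarrow> (\<forall>f. 0 \<le> quadratic_form p M f)"
  proof
    assume *: "\<forall>v\<in>carrier_vec p. 0 \<le> scalar_prod v (M *\<^sub>v v)"
    show "\<forall>f. 0 \<le> quadratic_form p M f"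
    proof
      fix f
      have "quadratic_form p M f = quadratic_form p M (vec_index (Matrix.vec p f))"
        by (rule quadratic_form_cong) simp
      also have "\<dots> = scalar_prod (Matrix.vec p f) (M *\<^sub>v Matrix.vec p f)"
        by (rule scalar_prod_mult_mat_vec[OF M vec_carrier, symmetric])
      finally show "0 \<le> quadratic_form p M f"
        using * vec_carrier[of p f] by simp
    qed
  qed (simp add: scalar_prod_mult_mat_vec[OF M])
  with sym M show ?thesis
    by (simp add: psd_mat_def)
qed (simp add: psd_mat_def)

lemma pd_mat_quadratic_form_pos:
  assumes "pd_mat p M" "a < p" "f a \<noteq> 0"
  shows "0 < quadratic_form p M f"
proof -
  have M: "M \<in> carrier_mat p p"
    using assms(1) by (simp add: pd_mat_def)
  have "Matrix.vec p f \<noteq> 0\<^sub>v p"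
    using assms(2,3) by (metis index_vec index_zero_vec(1))
  then have "0 < scalar_prod (Matrix.vec p f) (M *\<^sub>v Matrix.vec p f)"
    using assms(1) by (simp add: pd_mat_def)
  also have "\<dots> = quadratic_form p M f"
    by (simp add: scalar_prod_mult_mat_vec[OF M] cong: quadratic_form_cong)
  finally show ?thesis .
qed

lemma quadratic_form_scale: "quadratic_form p M (\<lambda>a. c * f a) = c\<^sup>2 * quadratic_form p M f"
  by (simp add: quadratic_form_def sum_distrib_left power2_eq_square algebra_simps)

text \<open>A copy of the unit sphere of dimension \<open>p\<close> inside the function space:
  coordinates from \<open>p\<close> on are pinned to 0, the others are boxed. The box is compact by
  Tychonoff, and the sphere is closed in it.\<close>

lemma compact_sum_squares_sphere:
  fixes p :: nat
  shows "compact {f :: nat \<Rightarrow> real. (\<forall>a. f a \<in> (if a < p then {-1..1} else {0})) \<and> (\<Sum>a<p. (f a)\<^sup>2) = 1}"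
proof -
  let ?B = "\<lambda>a::nat. if a < p then {-1..1::real} else {0}"
  have "compactin (product_topology (\<lambda>_. euclidean) UNIV) (Pi\<^sub>E UNIV ?B)"
    by (subst compactin_PiE) auto
  then have "compact (Pi\<^sub>E UNIV ?B)"
    by (simp add: euclidean_product_topology)
  moreover have "closed {f :: nat \<Rightarrow> real. (\<Sum>a<p. (f a)\<^sup>2) = 1}"
    by (intro closed_Collect_eq continuous_intros continuous_on_product_coordinates)
  ultimately have "compact (Pi\<^sub>E UNIV ?B \<inter> {f. (\<Sum>a<p. (f a)\<^sup>2) = 1})"
    by (rule compact_Int_closed)
  then show ?thesis
    by (simp add: PiE_UNIV_domain Pi_def Collect_conj_eq)
qed

text \<open>The form attains a positive minimum on the compact unit sphere, and it is homogeneous of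
  degree 2.\<close>

lemma pd_mat_coercive:
  assumes pd: "pd_mat p M"
  obtains c where "c > 0" "\<And>f. c * (\<Sum>a<p. (f a)\<^sup>2) \<le> quadratic_form p M f"
proof -
  define K where "K = {f :: nat \<Rightarrow> real. (\<forall>a. f a \<in> (if a < p then {-1..1} else {0})) \<and> (\<Sum>a<p. (f a)\<^sup>2) = 1}"
  have "\<exists>c>0. \<forall>f\<in>K. c \<le> quadratic_form p M f"
  proof (cases "K = {}")
    \<comment> \<open>The sphere is empty exactly when \<open>p = 0\<close>; any positive constant
      will do.\<close>
    case True
    then show ?thesis
      by (auto intro: exI[of _ 1])
  next
    case False
    have "continuous_on K (quadratic_form p M)"
      unfolding quadratic_form_def by (intro continuous_intros continuous_on_subset[OF continuous_on_product_coordinates] subset_UNIV)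
    then obtain f0 where f0: "f0 \<in> K" "\<forall>f\<in>K. quadratic_form p M f0 \<le> quadratic_form p M f"
      using continuous_attains_inf[OF compact_sum_squares_sphere[of p, folded K_def] False] by blast
    have "\<exists>a<p. f0 a \<noteq> 0"
      using f0(1) by (auto simp: K_def intro: ccontr)
    then have "0 < quadratic_form p M f0"
      using pd_mat_quadratic_form_pos[OF pd] by blast
    with f0(2) show ?thesis
      by blast
  qed
  then obtain c where c: "c > 0" "\<And>f. f \<in> K \<Longrightarrow> c \<le> quadratic_form p M f"
    by blast
  have "c * (\<Sum>a<p. (f a)\<^sup>2) \<le> quadratic_form p M f" for f
  proof (cases "(\<Sum>a<p. (f a)\<^sup>2) = 0")
    case True
    then have "f a = 0" if "a < p" for a
      using that by (auto simp: sum_nonneg_eq_0_iff)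
    then show ?thesis
      by (simp add: quadratic_form_def)
  next
    case False
    define r where "r = sqrt (\<Sum>a<p. (f a)\<^sup>2)"
    have r2: "r\<^sup>2 = (\<Sum>a<p. (f a)\<^sup>2)"
      by (simp add: r_def sum_nonneg)
    have r: "r > 0"
      using False by (simp add: r_def sum_nonneg less_le)
    \<comment> \<open>Normalised, and cut off at \<open>p\<close> to lie in \<open>K\<close>; the
      form does not see the coordinates cut off.\<close>
    define f' where "f' = (\<lambda>a. if a < p then f a / r else 0)"
    have sq: "(\<Sum>a<p. (f' a)\<^sup>2) = 1"
      using r by (simp add: f'_def power_divide r2 flip: sum_divide_distrib) (use False in simp)
    have "f' a \<in> {-1..1}" if "a < p" for a
    proof -
      have "(f' a)\<^sup>2 \<le> (\<Sum>a<p. (f' a)\<^sup>2)"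
        using that by (intro member_le_sum) auto
      then show ?thesis
        using sq by (simp add: power2_le_iff_abs_le abs_le_iff abs_square_le_1)
    qed
    then have "f' \<in> K"
      using sq by (auto simp: f'_def K_def)
    then have "c * r\<^sup>2 \<le> r\<^sup>2 * quadratic_form p M f'"
      using c(2) r by (simp add: mult.commute)
    also have "\<dots> = quadratic_form p M (\<lambda>a. r * f' a)"
      by (simp add: quadratic_form_scale)
    also have "\<dots> = quadratic_form p M f"
      using r by (intro quadratic_form_cong) (simp add: f'_def)
    finally show ?thesis
      by (simp add: r2)
  qed
  with c(1) show thesis
    using that by blast
qed

text \<open>Changing the entries by at most \<open>\<delta>\<close> changes the form by at most
  \<open>\<delta> * p\<close> times the sum of squares, since a product of two coordinates is at
  most the mean of their squares. Coercivity absorbs this.\<close>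

lemma pd_mat_perturbation:
  assumes pd: "pd_mat p M"
  obtains \<delta> where "\<delta> > 0"
    "\<And>N. \<lbrakk>N \<in> carrier_mat p p; \<And>a b. \<lbrakk>a < p; b < p\<rbrakk> \<Longrightarrow> N $$ (a, b) = N $$ (b, a);
       \<And>a b. \<lbrakk>a < p; b < p\<rbrakk> \<Longrightarrow> \<bar>N $$ (a, b) - M $$ (a, b)\<bar> \<le> \<delta>\<rbrakk> \<Longrightarrow> psd_mat p N"
proof -
  obtain c where c: "c > 0" "\<And>f. c * (\<Sum>a<p. (f a)\<^sup>2) \<le> quadratic_form p M f"
    by (rule pd_mat_coercive[OF pd]) (rule that; blast)
  \<comment> \<open>Dividing by \<open>p + 1\<close> keeps \<open>\<delta>\<close> positive for
    \<open>p = 0\<close> too and ensures \<open>\<delta> * p \<le> c\<close>.\<close>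
  define \<delta> where "\<delta> = c / (p + 1)"
  have \<delta>: "\<delta> > 0" "\<delta> * p \<le> c"
    using c(1) by (auto simp: \<delta>_def field_simps)
  have "psd_mat p N" if N: "N \<in> carrier_mat p p"
    and sym: "\<And>a b. \<lbrakk>a < p; b < p\<rbrakk> \<Longrightarrow> N $$ (a, b) = N $$ (b, a)"
    and near: "\<And>a b. \<lbrakk>a < p; b < p\<rbrakk> \<Longrightarrow> \<bar>N $$ (a, b) - M $$ (a, b)\<bar> \<le> \<delta>" for N
  proof -
    have "0 \<le> quadratic_form p N f" for f
    proof -
      let ?s = "\<Sum>a<p. (f a)\<^sup>2"
      have "quadratic_form p M f - quadratic_form p N f
          = (\<Sum>a<p. \<Sum>b<p. (M $$ (a, b) - N $$ (a, b)) * (f a * f b))"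
        by (simp add: quadratic_form_def algebra_simps flip: sum_subtractf)
      also have "\<dots> \<le> (\<Sum>a<p. \<Sum>b<p. \<delta> * (((f a)\<^sup>2 + (f b)\<^sup>2) / 2))"
      proof (intro sum_mono)
        fix a b assume ab: "a \<in> {..<p}" "b \<in> {..<p}"
        have "(M $$ (a, b) - N $$ (a, b)) * (f a * f b)
            \<le> \<bar>M $$ (a, b) - N $$ (a, b)\<bar> * \<bar>f a * f b\<bar>"
          by (metis abs_ge_self abs_mult)
        also have "\<dots> \<le> \<delta> * (((f a)\<^sup>2 + (f b)\<^sup>2) / 2)"
        proof (intro mult_mono)
          show "\<bar>M $$ (a, b) - N $$ (a, b)\<bar> \<le> \<delta>"
            using near[of a b] ab by (simp add: abs_minus_commute)
          have "0 \<le> (\<bar>f a\<bar> - \<bar>f b\<bar>)\<^sup>2"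
            by simp
          then show "\<bar>f a * f b\<bar> \<le> ((f a)\<^sup>2 + (f b)\<^sup>2) / 2"
            by (simp add: power2_diff abs_mult)
        qed (use \<delta> in auto)
        finally show "(M $$ (a, b) - N $$ (a, b)) * (f a * f b) \<le> \<delta> * (((f a)\<^sup>2 + (f b)\<^sup>2) / 2)" .
      qed
      also have "\<dots> = \<delta> * p * ?s"
      proof -
        have "(\<Sum>a<p. \<Sum>b<p. ((f a)\<^sup>2 + (f b)\<^sup>2)) = 2 * (p * ?s)"
          by (simp add: sum.distrib flip: sum_distrib_left)
        then show ?thesis
          by (simp flip: sum_distrib_left sum_divide_distrib)
      qed
      also have "\<dots> \<le> c * ?s"
        using \<delta> by (intro mult_right_mono) (auto simp: sum_nonneg)
      also have "\<dots> \<le> quadratic_form p M f"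
        by (rule c)
      finally show ?thesis
        by simp
    qed
    then show ?thesis
      using N sym by (simp add: psd_mat_iff)
  qed
  with \<delta>(1) show thesis
    using that by blast
qed

section \<open>Constraint sets: convexity and Slater points\<close>

lemma loewner_le_zero_iff:
  assumes "M \<in> carrier_mat p p"
  shows "loewner_le p M (0\<^sub>m p p) \<longleftrightarrow>
    (\<forall>a<p. \<forall>b<p. M $$ (a, b) = M $$ (b, a)) \<and> (\<forall>f. quadratic_form p M f \<le> 0)"
  using assms by (auto simp: loewner_le_def psd_mat_iff quadratic_form_def sum_negf)

text \<open>The two contents of positive semidefiniteness of the convexity gap: its symmetry, from
  which symmetry of one value of \<open>g\<close> follows from that of the other two, and scalar
  convexity of each quadratic form. Naming the middle point \<open>W\<close> allows it to be a given
  point such as \<open>z\<close>.\<close>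

lemma loewner_convexD:
  assumes "loewner_convex p g" "\<And>X. g X \<in> carrier_mat p p" "0 \<le> t" "t \<le> 1"
    and "W = (1 - t) *\<^sub>R X + t *\<^sub>R Y"
  shows "\<lbrakk>a < p; b < p\<rbrakk> \<Longrightarrow> (1 - t) * g X $$ (a, b) + t * g Y $$ (a, b) - g W $$ (a, b)
      = (1 - t) * g X $$ (b, a) + t * g Y $$ (b, a) - g W $$ (b, a)"
    and "quadratic_form p (g W) f
      \<le> (1 - t) * quadratic_form p (g X) f + t * quadratic_form p (g Y) f"
proof -
  let ?D = "(1 - t) \<cdot>\<^sub>m g X + t \<cdot>\<^sub>m g Y - g W"
  have D: "?D $$ (a, b) = (1 - t) * g X $$ (a, b) + t * g Y $$ (a, b) - g W $$ (a, b)"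
    if "a < p" "b < p" for a b
    using that assms(2)[of X] assms(2)[of Y] assms(2)[of W] by auto
  have "psd_mat p ?D"
    using assms by (auto simp: loewner_convex_def loewner_le_def)
  then have sym: "\<And>a b. \<lbrakk>a < p; b < p\<rbrakk> \<Longrightarrow> ?D $$ (a, b) = ?D $$ (b, a)"
    and "0 \<le> quadratic_form p ?D f"
    by (auto simp: psd_mat_iff)
  note this(2)
  also have "quadratic_form p ?D f = (1 - t) * quadratic_form p (g X) f
      + t * quadratic_form p (g Y) f - quadratic_form p (g W) f"
  proof -
    have "quadratic_form p ?D f = (\<Sum>a<p. \<Sum>b<p. (1 - t) * (f a * g X $$ (a, b) * f b)
        + t * (f a * g Y $$ (a, b) * f b) - f a * g W $$ (a, b) * f b)"
      unfolding quadratic_form_def by (intro sum.cong refl) (simp add: D algebra_simps)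
    then show ?thesis
      by (simp add: quadratic_form_def sum_distrib_left sum.distrib sum_subtractf)
  qed
  finally show "quadratic_form p (g W) f
      \<le> (1 - t) * quadratic_form p (g X) f + t * quadratic_form p (g Y) f"
    by simp
  show "(1 - t) * g X $$ (a, b) + t * g Y $$ (a, b) - g W $$ (a, b)
      = (1 - t) * g X $$ (b, a) + t * g Y $$ (b, a) - g W $$ (b, a)" if "a < p" "b < p"
    using sym[OF that] D that by simp
qed

lemma trace_transpose_left_eq_inner: "trace (transpose C ** \<Delta>) = C \<bullet> (\<Delta> :: real^'n^'n)"
  by (metis inner_commute trace_mul_sym trace_transpose_eq_inner)

lemma convex_constraint_set:
  assumes data: "constraint_data L h K p g"
  shows "convex (constraint_set I C q L h K p g)"
  unfolding convex_alt
proof (intro ballI allI impI, elim conjE)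
  fix X Y and t :: real
  assume X: "X \<in> constraint_set I C q L h K p g" and Y: "Y \<in> constraint_set I C q L h K p g"
    and t: "0 \<le> t" "t \<le> 1"
  define W where "W = (1 - t) *\<^sub>R X + t *\<^sub>R Y"
  have "trace (transpose (C j) ** W) + q j = 0" if "j \<in> {1..I}" for j
  proof -
    have "C j \<bullet> X = - q j" "C j \<bullet> Y = - q j"
      using X Y that by (auto simp: constraint_set_def trace_transpose_left_eq_inner eq_neg_iff_add_eq_0)
    then show ?thesis
      by (simp add: W_def trace_transpose_left_eq_inner inner_add_right algebra_simps)
  qed
  moreover have "h l W \<le> 0" if "l \<in> {1..L}" for l
  proof -
    have "h l W \<le> (1 - t) * h l X + t * h l Y"
      using data that t convex_onD[of UNIV "h l" t X Y]
      by (auto simp: W_def constraint_data_def)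
    also have "\<dots> \<le> 0"
      using X Y that t by (auto simp: constraint_set_def intro!: add_nonpos_nonpos mult_nonneg_nonpos)
    finally show ?thesis .
  qed
  moreover have "loewner_le p (g r W) (0\<^sub>m p p)" if r: "r \<in> {1..K}" for r
  proof -
    have car: "\<And>\<Delta>. g r \<Delta> \<in> carrier_mat p p" and cx: "loewner_convex p (g r)"
      using data r by (auto simp: constraint_data_def)
    note cxD = loewner_convexD[OF cx car t W_def]
    have gX: "\<forall>a<p. \<forall>b<p. g r X $$ (a, b) = g r X $$ (b, a)" "\<forall>f. quadratic_form p (g r X) f \<le> 0"
      and gY: "\<forall>a<p. \<forall>b<p. g r Y $$ (a, b) = g r Y $$ (b, a)" "\<forall>f. quadratic_form p (g r Y) f \<le> 0"
      using X Y r loewner_le_zero_iff[OF car] unfolding constraint_set_def by blast+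
    \<comment> \<open>Being below zero in the Loewner order includes symmetry; feasibility gives it
      at \<open>X\<close> and \<open>Y\<close>, and the symmetric gap carries it over to
      \<open>W\<close>.\<close>
    have "g r W $$ (a, b) = g r W $$ (b, a)" if "a < p" "b < p" for a b
      using cxD(1)[OF that] gX(1)[rule_format, OF that] gY(1)[rule_format, OF that] by simp
    moreover have "quadratic_form p (g r W) f \<le> 0" for f
    proof -
      have "(1 - t) * quadratic_form p (g r X) f + t * quadratic_form p (g r Y) f \<le> 0"
        using t gX(2) gY(2) by (intro add_nonpos_nonpos mult_nonneg_nonpos) auto
      with cxD(2)[of f] show ?thesis
        by linarith
    qed
    ultimately show ?thesis
      by (simp add: loewner_le_zero_iff[OF car])
  qed
  ultimately show "(1 - t) *\<^sub>R X + t *\<^sub>R Y \<in> constraint_set I C q L h K p g"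
    by (simp add: constraint_set_def W_def)
qed

lemma slater_point_rel_interior:
  assumes data: "constraint_data L h K p g" and sl: "slater_point I C q L h K p g z"
  shows "z \<in> rel_interior (constraint_set I C q L h K p g)"
proof -
  let ?Z = "constraint_set I C q L h K p g"
  have zZ: "z \<in> ?Z"
    using sl by (simp add: slater_point_def)
  have "\<exists>e>1. (1 - e) *\<^sub>R x + e *\<^sub>R z \<in> ?Z" if xZ: "x \<in> ?Z" for x
  proof -
    \<comment> \<open>The line from \<open>x\<close> through \<open>z\<close>, reached at parameter
      1. Finitely many constraints that each hold just to the right of 1 hold there
      simultaneously.\<close>
    define \<gamma> where "\<gamma> = (\<lambda>e::real. (1 - e) *\<^sub>R x + e *\<^sub>R z)"
    have "(\<gamma> \<longlongrightarrow> (1 - 1) *\<^sub>R x + 1 *\<^sub>R z) (at_right 1)"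
      unfolding \<gamma>_def by (intro tendsto_intros)
    then have lim: "(\<gamma> \<longlongrightarrow> z) (at_right 1)"
      by simp
    have eq: "trace (transpose (C j) ** \<gamma> e) + q j = 0" if "j \<in> {1..I}" for j e
    proof -
      have "C j \<bullet> x = - q j" "C j \<bullet> z = - q j"
        using xZ zZ that by (auto simp: constraint_set_def trace_transpose_left_eq_inner eq_neg_iff_add_eq_0)
      then show ?thesis
        by (simp add: \<gamma>_def trace_transpose_left_eq_inner inner_add_right algebra_simps)
    qed
    have "\<forall>\<^sub>F e in at_right 1. h l (\<gamma> e) \<le> 0" if "l \<in> {1..L}" for l
    proof -
      have "isCont (h l) z" "h l z < 0"
        using data sl that
        by (auto simp: constraint_data_def slater_point_def continuous_on_eq_continuous_at)
      then have "\<forall>\<^sub>F e in at_right 1. h l (\<gamma> e) < 0"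
        using isCont_tendsto_compose[OF _ lim] order_tendstoD(2) by blast
      then show ?thesis
        by (rule eventually_mono) simp
    qed
    then have evh: "\<forall>\<^sub>F e in at_right 1. \<forall>l\<in>{1..L}. h l (\<gamma> e) \<le> 0"
      by (simp add: eventually_ball_finite)
    have "\<forall>\<^sub>F e in at_right 1. loewner_le p (g r (\<gamma> e)) (0\<^sub>m p p)" if r: "r \<in> {1..K}" for r
    proof -
      have car: "\<And>\<Delta>. g r \<Delta> \<in> carrier_mat p p" and cx: "loewner_convex p (g r)"
        and cont: "\<And>a b. \<lbrakk>a < p; b < p\<rbrakk> \<Longrightarrow> isCont (\<lambda>X. g r X $$ (a, b)) z"
        using data r
        by (auto simp: constraint_data_def entrywise_continuous_def continuous_on_eq_continuous_at)
      have "pd_mat p (0\<^sub>m p p - g r z)"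
        using sl r by (auto simp: slater_point_def loewner_less_def)
      then obtain \<delta> where \<delta>: "\<delta> > 0" and psd:
        "\<And>N. \<lbrakk>N \<in> carrier_mat p p; \<And>a b. \<lbrakk>a < p; b < p\<rbrakk> \<Longrightarrow> N $$ (a, b) = N $$ (b, a);
           \<And>a b. \<lbrakk>a < p; b < p\<rbrakk> \<Longrightarrow> \<bar>N $$ (a, b) - (0\<^sub>m p p - g r z) $$ (a, b)\<bar> \<le> \<delta>\<rbrakk>
           \<Longrightarrow> psd_mat p N"
        by (rule pd_mat_perturbation) (rule that; blast)
      have symx: "g r x $$ (a, b) = g r x $$ (b, a)" and symz: "g r z $$ (a, b) = g r z $$ (b, a)"
        if "a < p" "b < p" for a b
        using xZ zZ r that loewner_le_zero_iff[OF car] unfolding constraint_set_def by blast+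
      \<comment> \<open>Values of a Loewner-convex map need not be symmetric, but the antisymmetric part is affine;
        it vanishes at \<open>x\<close> and \<open>z\<close>, hence on the line through them.\<close>
      have symw: "g r (\<gamma> e) $$ (a, b) = g r (\<gamma> e) $$ (b, a)" if e: "e > 1" and ab: "a < p" "b < p" for e a b
      proof -
        \<comment> \<open>Solves for \<open>z\<close> as a convex combination of
          \<open>\<gamma> e\<close> and \<open>x\<close>; the weight of \<open>\<gamma> e\<close> is
          \<open>1 / e\<close>, which is nonzero and can be cancelled.\<close>
        define t where "t = 1 - 1 / e"
        have t: "0 \<le> t" "t \<le> 1" "1 - t \<noteq> 0"
          using e by (auto simp: t_def)
        have "z = (1 - t) *\<^sub>R \<gamma> e + t *\<^sub>R x"
          using e by (simp add: \<gamma>_def t_def algebra_simps)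
        from loewner_convexD(1)[OF cx car t(1,2) this ab]
        show ?thesis
          using symx[OF ab] symz[OF ab] t(3) by simp
      qed
      have "\<forall>\<^sub>F e in at_right 1. \<forall>a\<in>{..<p}. \<forall>b\<in>{..<p}. dist (g r (\<gamma> e) $$ (a, b)) (g r z $$ (a, b)) < \<delta>"
        using isCont_tendsto_compose[OF cont lim] \<delta>
        by (intro eventually_ball_finite ballI tendstoD) auto
      moreover have "\<forall>\<^sub>F e in at_right 1. (e::real) > 1"
        by (rule eventually_at_right_less)
      ultimately show ?thesis
      proof eventually_elim
        case (elim e)
        have ix: "(0\<^sub>m p p - g r X) $$ (a, b) = - g r X $$ (a, b)" if "a < p" "b < p" for X a b
          using car[of X] that by auto
        have "psd_mat p (0\<^sub>m p p - g r (\<gamma> e))"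
        proof (rule psd)
          show "0\<^sub>m p p - g r (\<gamma> e) \<in> carrier_mat p p"
            using car by (intro minus_carrier_mat)
        next
          fix a b assume ab: "a < p" "b < p"
          show "(0\<^sub>m p p - g r (\<gamma> e)) $$ (a, b) = (0\<^sub>m p p - g r (\<gamma> e)) $$ (b, a)"
            using symw[OF elim(2) ab] ab by (simp add: ix)
          have "\<bar>g r (\<gamma> e) $$ (a, b) - g r z $$ (a, b)\<bar> < \<delta>"
            using elim(1) ab by (simp add: dist_real_def)
          then show "\<bar>(0\<^sub>m p p - g r (\<gamma> e)) $$ (a, b) - (0\<^sub>m p p - g r z) $$ (a, b)\<bar> \<le> \<delta>"
            using ab by (simp add: ix)
        qed
        then show ?case
          by (simp add: loewner_le_def)
      qed
    qed
    then have "\<forall>\<^sub>F e in at_right 1. \<forall>r\<in>{1..K}. loewner_le p (g r (\<gamma> e)) (0\<^sub>m p p)"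
      by (simp add: eventually_ball_finite)
    with evh have "\<forall>\<^sub>F e in at_right 1. e > 1 \<and> \<gamma> e \<in> ?Z"
      using eventually_at_right_less[of "1::real"]
      by eventually_elim (simp add: constraint_set_def eq)
    then obtain e where "e > 1 \<and> \<gamma> e \<in> ?Z"
      using eventually_happens'[OF trivial_limit_at_right_real] by blast
    then show ?thesis
      by (auto simp: \<gamma>_def)
  qed
  then show ?thesis
    using convex_rel_interior_iff[OF convex_constraint_set[OF data]] zZ by blast
qed

section \<open>Support function of an intersection\<close>

text \<open>Weak duality: a point of the intersection competes in every supremum on the
  right.\<close>

lemma support_mat_Inter_le:
  fixes Z :: "'k::finite \<Rightarrow> (real^'n^'m) set"
  shows "support_mat (\<Inter>i. Z i) (\<Sum>i\<in>UNIV. V i) \<le> (\<Sum>i\<in>UNIV. support_mat (Z i) (V i))"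
  unfolding support_mat_inner
proof (rule SUP_least)
  fix \<Delta> assume "\<Delta> \<in> (\<Inter>i. Z i)"
  then have "(\<Sum>i\<in>UNIV. ereal (\<Delta> \<bullet> V i)) \<le> (\<Sum>i\<in>UNIV. SUP \<Delta>\<in>Z i. ereal (\<Delta> \<bullet> V i))"
    by (intro sum_mono SUP_upper) auto
  then show "ereal (\<Delta> \<bullet> (\<Sum>i\<in>UNIV. V i)) \<le> (\<Sum>i\<in>UNIV. SUP \<Delta>\<in>Z i. ereal (\<Delta> \<bullet> V i))"
    by (simp add: inner_sum_right)
qed

lemma support_mat_Inter_attained:
  fixes Z :: "'k::finite \<Rightarrow> (real^'n^'m) set"
  assumes conv: "\<And>i. convex (Z i)" and z: "\<And>i. z \<in> rel_interior (Z i)"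
  shows "\<exists>V. (\<Sum>i\<in>UNIV. V i) = U \<and>
    support_mat (\<Inter>i. Z i) U = (\<Sum>i\<in>UNIV. support_mat (Z i) (V i))"
proof -
  have zZ: "z \<in> Z i" for i
    using z rel_interior_subset by blast
  have upper: "ereal (y \<bullet> U) \<le> support_mat (\<Inter>i. Z i) U" if "y \<in> (\<Inter>i. Z i)" for y
    unfolding support_mat_inner using that by (rule SUP_upper)
  show ?thesis
  proof (cases "support_mat (\<Inter>i. Z i) U")
    case (real s)
    have bd: "y \<bullet> U \<le> s" if "y \<in> (\<Inter>i. Z i)" for y
      using upper[OF that] real by simp
    obtain V where V: "(\<Sum>i\<in>UNIV. V i) = U"
      "\<And>x. (\<And>i. x i \<in> Z i) \<Longrightarrow> (\<Sum>i\<in>UNIV. x i \<bullet> V i) \<le> s"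
      using support_Inter_decomposition[of Z z U s, OF conv z bd] by metis
    have nMInf: "support_mat (Z i) (V i) \<noteq> -\<infinity>" for i
    proof -
      have "ereal (z \<bullet> V i) \<le> support_mat (Z i) (V i)"
        unfolding support_mat_inner by (rule SUP_upper[OF zZ])
      then show ?thesis
        by auto
    qed
    \<comment> \<open>No summand is \<open>-\<infinity>\<close>, so the sum may be rewritten as one
      supremum over families, which the separation result bounds by \<open>s\<close>.\<close>
    have "(\<Sum>i\<in>UNIV. support_mat (Z i) (V i)) = lower_sum (\<lambda>i. support_mat (Z i) (V i)) UNIV"
      using nMInf by (simp add: lower_sum_eq_sum)
    also have "\<dots> \<le> ereal s"
      unfolding support_mat_inner lower_sum_SUP using V(2) by (intro SUP_least) auto
    finally have "(\<Sum>i\<in>UNIV. support_mat (Z i) (V i)) \<le> support_mat (\<Inter>i. Z i) U"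
      using real by simp
    then show ?thesis
      using V(1) support_mat_Inter_le[of Z V] by (auto intro!: exI[of _ V] antisym)
  next
    case PInf
    \<comment> \<open>By weak duality every decomposition of \<open>U\<close> has value
      \<open>\<infinity>\<close> here; this one puts all of \<open>U\<close> on one arbitrary index,
      for which \<open>undefined\<close> stands.\<close>
    define V :: "'k \<Rightarrow> real^'n^'m" where "V = (\<lambda>i. if i = undefined then U else 0)"
    have "(\<Sum>i\<in>UNIV. V i) = U"
      by (simp add: V_def)
    moreover from this have "(\<Sum>i\<in>UNIV. support_mat (Z i) (V i)) = \<infinity>"
      using support_mat_Inter_le[of Z V] PInf by simp
    ultimately show ?thesis
      using PInf by auto
  next
    case MInf
    then show ?thesis
      using upper[of z] zZ by simp
  qed
qed

text \<open>In (iv), an empty preimage would have value \<open>-\<infinity>\<close>, hence the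
  nonemptiness condition in the infinite case. In (v) and (vii), one empty set empties the whole
  construction, hence \<open>lower_sum\<close>. In (vi), the minimum is expressed by attainment and
  a lower bound; all sets contain the Slater point, so ordinary addition is unambiguous.\<close>

theorem lemma2:
  fixes U :: "real^'n^'n"
  shows
    \<comment> \<open>(i)\<close>
    "(\<forall>S :: (real^('n \<times> 'n)) set. convex S \<longrightarrow>
        support_mat {\<Delta>. vec_rows \<Delta> \<in> S} U = support_vec S (vec_rows U))
    \<and>
    \<comment> \<open>(ii)\<close>
    (\<forall>(D :: 'k::finite \<Rightarrow> real^'n^'n) (S :: (real^'k) set). convex S \<longrightarrow>
        support_mat {(\<Sum>i\<in>UNIV. \<zeta> $ i *\<^sub>R D i) | \<zeta>. \<zeta> \<in> S} U =
        support_vec S (\<chi> i. trace (D i ** transpose U)))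
    \<and>
    \<comment> \<open>(iii)\<close>
    (\<forall>(L :: real^'t^'n) (R :: real^'n^'s) (S :: (real^'s^'t) set). convex S \<longrightarrow>
        support_mat {L ** \<Delta> ** R | \<Delta>. \<Delta> \<in> S} U =
        support_mat S (transpose L ** U ** transpose R))
    \<and>
    \<comment> \<open>(iv)\<close>
    (\<forall>(L :: real^'n^'n) (S :: (real^'n^'n) set). convex S \<longrightarrow>
        (pattern_compatible L S \<longrightarrow>
          (\<forall>i j. L $ i $ j = 0 \<longrightarrow> U $ i $ j = 0) \<longrightarrow>
          support_mat {\<Delta>. L \<circ>\<^sub>H \<Delta> \<in> S} U = support_mat S (U \<circ>\<^sub>H entry_inverse L)) \<and>
        ({\<Delta>. L \<circ>\<^sub>H \<Delta> \<in> S} \<noteq> {} \<longrightarrow>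
          (\<exists>i j. L $ i $ j = 0 \<and> U $ i $ j \<noteq> 0) \<longrightarrow>
          support_mat {\<Delta>. L \<circ>\<^sub>H \<Delta> \<in> S} U = \<infinity>))
    \<and>
    \<comment> \<open>(v)\<close>
    (\<forall>Z :: 'k \<Rightarrow> (real^'n^'n) set. (\<forall>i. convex (Z i)) \<longrightarrow>
        support_mat (\<Sum>i\<in>UNIV. Z i) U = lower_sum (\<lambda>i. support_mat (Z i) U) UNIV)
    \<and>
    \<comment> \<open>(vi)\<close>
    (\<forall>(Z :: 'k \<Rightarrow> (real^'n^'n) set) I C q L h K p g.
        (\<forall>i. constraint_data (L i) (h i) (K i) (p i) (g i)) \<longrightarrow>
        (\<forall>i. Z i = constraint_set (I i) (C i) (q i) (L i) (h i) (K i) (p i) (g i)) \<longrightarrow>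
        (\<exists>\<Delta>. \<forall>i. slater_point (I i) (C i) (q i) (L i) (h i) (K i) (p i) (g i) \<Delta>) \<longrightarrow>
        (\<exists>V. (\<Sum>i\<in>UNIV. V i) = U \<and>
             support_mat (\<Inter>i. Z i) U = (\<Sum>i\<in>UNIV. support_mat (Z i) (V i))) \<and>
        (\<forall>V. (\<Sum>i\<in>UNIV. V i) = U \<longrightarrow>
             support_mat (\<Inter>i. Z i) U \<le> (\<Sum>i\<in>UNIV. support_mat (Z i) (V i))))
    \<and>
    \<comment> \<open>(vii)\<close>
    (\<forall>(n :: 'k \<Rightarrow> nat) (Z :: 'k \<Rightarrow> real mat set) (W :: 'k \<Rightarrow> real mat).
        (\<forall>i. Z i \<subseteq> carrier_mat (n i) (n i) \<and> convex_mats (Z i) \<and>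
             W i \<in> carrier_mat (n i) (n i)) \<longrightarrow>
        support_tuple {\<Delta>. \<forall>i. \<Delta> i \<in> Z i} W =
        lower_sum (\<lambda>i. support_var_mat (Z i) (W i)) UNIV)
    \<and>
    \<comment> \<open>(viii)\<close>
    (\<forall>Z :: 'k \<Rightarrow> (real^'n^'n) set. (\<forall>i. convex (Z i)) \<longrightarrow>
        support_mat (convex hull (\<Union>i. Z i)) U = Max (range (\<lambda>i. support_mat (Z i) U)))"
proof (intro conjI allI impI)
  fix Z :: "'k \<Rightarrow> (real^'n^'n) set" and I C q L h K p g
  assume data: "\<forall>i. constraint_data (L i) (h i) (K i) (p i) (g i)"
    and Z: "\<forall>i. Z i = constraint_set (I i) (C i) (q i) (L i) (h i) (K i) (p i) (g i)"
    and "\<exists>\<Delta>. \<forall>i. slater_point (I i) (C i) (q i) (L i) (h i) (K i) (p i) (g i) \<Delta>"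
  then obtain z where "\<And>i. slater_point (I i) (C i) (q i) (L i) (h i) (K i) (p i) (g i) z"
    by blast
  then have "z \<in> rel_interior (Z i)" for i
    using data Z by (simp add: slater_point_rel_interior)
  moreover have "convex (Z i)" for i
    using data Z by (simp add: convex_constraint_set)
  ultimately show "\<exists>V. (\<Sum>i\<in>UNIV. V i) = U \<and>
      support_mat (\<Inter>i. Z i) U = (\<Sum>i\<in>UNIV. support_mat (Z i) (V i))"
    by (intro support_mat_Inter_attained)
next
  fix Z :: "'k \<Rightarrow> (real^'n^'n) set" and V :: "'k \<Rightarrow> real^'n^'n"
  assume "(\<Sum>i\<in>UNIV. V i) = U"
  then show "support_mat (\<Inter>i. Z i) U \<le> (\<Sum>i\<in>UNIV. support_mat (Z i) (V i))"
    using support_mat_Inter_le by blast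
qed (auto simp only: support_mat_vec_rows_vimage support_mat_linear_combinations support_mat_mult
    support_mat_sum support_tuple_Pi support_mat_convex_hull_UN
    intro!: support_mat_hadamard_vimage support_mat_hadamard_vimage_infinite)

end
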